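(* Let $\lambda$ be an indeterminate and let $m,n$ be integers with $1\le m\le n$. Then the following two identities hold: $$\text{(a)}\quad\sum_{i=m}^n\sum_{j=m}^i(-1)^{n+i}\begin{bmatrix}n\\ i\end{bmatrix}\binom{i}{j}\begin{Bmatrix}j\\ m\end{Bmatrix}\lambda^{i-j}2^{n-j}=\frac{n!}{m!}\sum_{\ell=m}^n\frac{m}{\ell}\binom{\lambda}{n-\ell}\binom{-\ell}{\ell-m}2^{m+n-2\ell},$$ $$\text{(b)}\quad\sum_{i=m}^n\sum_{j=m}^i(-1)^{m+i}\begin{bmatrix}n\\ i\end{bmatrix}\binom{i}{j}\begin{Bmatrix}j\\ m\end{Bmatrix}\lambda^{i-j}2^{j-m}=\frac{n!}{m!}\sum_{\ell=m}^n(-1)^{m+n}\binom{\lambda}{n-\ell}\binom{m}{\ell-m}2^{m-\ell}.$$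
   Context: For an indeterminate (or number) $u$ the falling factorial is $\langle u\rangle_0=1$ and $\langle u\rangle_n=u(u-1)\cdots(u-n+1)$ for $n\ge 1$; the generalized binomial coefficient is $\binom{u}{n}=\langle u\rangle_n/n!$ for integers $n\ge 0$ (in particular this applies to the negative upper argument $-\ell$). The unsigned Stirling numbers of the first kind $\begin{bmatrix}n\\ k\end{bmatrix}$ are defined by $\langle u\rangle_n=\sum_{k=0}^n(-1)^{n-k}\begin{bmatrix}n\\ k\end{bmatrix}u^k$, and the Stirling numbers of the second kind $\begin{Bmatrix}n\\ k\end{Bmatrix}$ by $u^n=\sum_{k=0}^n\begin{Bmatrix}n\\ k\end{Bmatrix}\langle u\rangle_k$. When $\lambda$ is specialized to $0$, $\lambda^0=1$. Powers of $2$ with negative exponent are rational numbers. *)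

theory Defs
  imports "HOL-Combinatorics.Stirling" "HOL-Computational_Algebra.Polynomial"
begin

text \<open>
  The identities live in the polynomial ring over the rationals; the indeterminate is its
  generator.
\<close>

abbreviation lam :: "rat poly" where
  "lam \<equiv> [:0, 1:]"

definition ffact :: "'a::comm_ring_1 \<Rightarrow> nat \<Rightarrow> 'a" where
  "ffact u n = (\<Prod>i<n. u - of_nat i)"

text \<open>
  The library defines both kinds of Stirling numbers by their recurrences.  The following two
  lemmas show that \<open>stirling\<close> (first kind, unsigned) and \<open>Stirling\<close> (second kind) are the
  connection coefficients between powers and falling factorials.
\<close>

lemma ffact_eq_sum_stirling:
  "ffact u n = (\<Sum>k\<le>n. (-1) ^ (n - k) * of_nat (stirling n k) * u ^ k)"
proof -
  have "ffact u n = (-1) ^ n * pochhammer (- u) n"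
    unfolding ffact_def
  proof (induction n)
    case (Suc n)
    then show ?case by (simp add: pochhammer_Suc algebra_simps)
  qed simp
  also have "\<dots> = (\<Sum>k\<le>n. (-1) ^ n * (of_nat (stirling n k) * (- u) ^ k))"
    by (simp add: stirling_pochhammer [symmetric] sum_distrib_left)
  also have "\<dots> = (\<Sum>k\<le>n. (-1) ^ (n - k) * of_nat (stirling n k) * u ^ k)"
  proof (rule sum.cong [OF refl])
    fix k assume "k \<in> {..n}"
    then have "n = (n - k) + k" by simp
    then have "(-1) ^ n = (-1) ^ (n - k) * ((-1) ^ k :: 'a)"
      by (metis power_add)
    moreover have "(-1) ^ k * ((-1) ^ k :: 'a) = 1"
      by (metis minus_one_mult_self)
    moreover have "(- u) ^ k = (-1) ^ k * u ^ k"
      by (rule power_minus)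
    ultimately show "(-1) ^ n * (of_nat (stirling n k) * (- u) ^ k)
        = (-1) ^ (n - k) * of_nat (stirling n k) * u ^ k"
      by (metis (no_types, opaque_lifting) mult.assoc mult.left_commute mult_1)
  qed
  finally show ?thesis .
qed

lemma power_eq_sum_Stirling:
  "u ^ n = (\<Sum>k\<le>n. of_nat (Stirling n k) * ffact u k)"
proof (induction n)
  case 0
  then show ?case by (simp add: ffact_def)
next
  case (Suc n)
  let ?S = "\<lambda>n k. of_nat (Stirling n k) :: 'a"
  have step: "u * ffact u k = ffact u (Suc k) + of_nat k * ffact u k" for k
    by (simp add: ffact_def algebra_simps)
  have "(\<Sum>k\<le>Suc n. ?S (Suc n) k * ffact u k)
      = (\<Sum>k\<le>n. ?S (Suc n) (Suc k) * ffact u (Suc k))"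
    by (subst sum.atMost_Suc_shift) simp
  also have "\<dots> = (\<Sum>k\<le>n. of_nat (Suc k) * ?S n (Suc k) * ffact u (Suc k))
      + (\<Sum>k\<le>n. ?S n k * ffact u (Suc k))"
    by (simp add: sum.distrib [symmetric] algebra_simps)
  also have "(\<Sum>k\<le>n. of_nat (Suc k) * ?S n (Suc k) * ffact u (Suc k))
      = (\<Sum>k\<le>Suc n. of_nat k * ?S n k * ffact u k)"
    by (subst sum.atMost_Suc_shift) simp
  also have "\<dots> = (\<Sum>k\<le>n. of_nat k * ?S n k * ffact u k)"
    by simp
  also have "\<dots> + (\<Sum>k\<le>n. ?S n k * ffact u (Suc k)) = (\<Sum>k\<le>n. ?S n k * (u * ffact u k))"
    by (simp add: sum.distrib [symmetric] step algebra_simps)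
  also have "\<dots> = u ^ Suc n"
    by (simp add: Suc sum_distrib_left algebra_simps)
  finally show ?case by simp
qed

text \<open>
  The library's \<open>gchoose\<close> is restricted to fields of characteristic 0, so it does not apply to
  a polynomial upper argument.  Evaluating the polynomial version below gives \<open>gchoose\<close>.
\<close>

definition pbinomial :: "'a::field_char_0 poly \<Rightarrow> nat \<Rightarrow> 'a poly"  (infix "pchoose" 64) where
  "p pchoose n = smult (1 / fact n) (ffact p n)"

lemma poly_pbinomial: "poly (p pchoose n) x = poly p x gchoose n"
  by (simp add: pbinomial_def ffact_def gbinomial_prod_rev atLeast0LessThan poly_prod)

end

theory Submission
  imports Defs "HOL-Computational_Algebra.Formal_Power_Series"
begin

text \<open>
  Write \<open>(1 + t)\<^sup>x\<close> for the formal binomial series \<open>fps_binomial x\<close>.  Both double sums are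
  values of one expression with a parameter \<open>a\<close>, namely the sum over \<open>i\<close> and \<open>j\<close> of
  \<open>(-1) ^ (n - i) * stirling n i * (i choose j) * Stirling j m * x ^ (i - j) * a ^ j\<close>: up to powers
  of 2 and a sign, \<open>a = 1/2\<close> gives the left side of the first identity and \<open>a = 2\<close> that of the
  second.

  This expression is \<open>n!/m!\<close> times the coefficient of \<open>t\<^sup>n\<close> in
  \<open>(1 + t)\<^sup>x ((1 + t)\<^sup>a - 1)\<^sup>m\<close> (\<open>Stirling_double_sum_eq_fps_nth\<close>).  The reason is that numbers of
  the second kind are \<open>m\<close>-th differences of powers divided by \<open>m!\<close>, so that the sum over \<open>j\<close> is an \<open>m\<close>-th
  difference of \<open>x\<^sup>i\<close> with step \<open>a\<close>; numbers of the first kind then turn powers into falling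
  factorials, which leaves an \<open>m\<close>-th difference of binomial coefficients.

  The factor \<open>(1 + t)\<^sup>x\<close> contributes the binomial coefficients of the indeterminate on the right,
  and it remains to expand \<open>((1 + t)\<^sup>a - 1)\<^sup>m\<close>.  For \<open>a = 2\<close> it is \<open>t\<^sup>m (t + 2)\<^sup>m\<close>.  For \<open>a = 1/2\<close>
  the series \<open>w = (1 + t)\<^sup>a - 1\<close> is the compositional inverse of \<open>2 w + w\<^sup>2\<close>, and
  \<open>fps_sqrt_minus_one_power_nth\<close> gives the coefficients that Lagrange inversion predicts.
\<close>

unbundle fps_syntax

section \<open>Finite differences and formal binomial series\<close>

text \<open>
  The sum is an \<open>m\<close>-th finite difference with step \<open>a\<close>.  On binomial series a shift of the exponent
  by \<open>a\<close> is multiplication by \<open>(1 + t)\<^sup>a\<close>, so the difference operator is multiplication by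
  \<open>(1 + t)\<^sup>a - 1\<close>.
\<close>

lemma alternating_sum_gbinomial_eq_fps_nth:
  fixes x a :: "'a::field_char_0"
  shows "(\<Sum>k\<le>m. (-1) ^ (m - k) * of_nat (m choose k) * ((x + of_nat k * a) gchoose n))
    = (fps_binomial x * (fps_binomial a - 1) ^ m) $ n"
proof -
  have "(fps_binomial a - 1) ^ m = (fps_binomial a + (- 1)) ^ m" by simp
  also have "\<dots> = (\<Sum>k\<le>m. of_nat (m choose k) * fps_binomial a ^ k * (-1) ^ (m - k))"
    by (rule binomial_ring)
  finally have "fps_binomial x * (fps_binomial a - 1) ^ m
      = (\<Sum>k\<le>m. fps_const ((-1) ^ (m - k) * of_nat (m choose k)) * fps_binomial (x + of_nat k * a))"
    by (simp add: sum_distrib_left fps_binomial_add_mult fps_binomial_power mult_ac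
        fps_of_nat fps_const_power [symmetric] fps_const_neg [symmetric]
        flip: fps_const_mult)
  then show ?thesis by (simp add: fps_sum_nth)
qed

lemma ffact_eq_fact_gbinomial:
  "ffact u n = fact n * (u gchoose n)" for u :: "'a::field_char_0"
  by (simp add: ffact_def gbinomial_prod_rev atLeast0LessThan)

text \<open>
  The classical closed form: expand \<open>k\<^sup>j\<close> in the binomial coefficients \<open>k gchoose i\<close>.  Their \<open>m\<close>-th
  differences at 0 with step 1 are the coefficients at \<open>t\<^sup>i\<close> of the monomial \<open>t\<^sup>m\<close>, so only \<open>i = m\<close> survives.
\<close>

lemma fact_Stirling_eq_alternating_sum:
  "fact m * of_nat (Stirling j m)
    = (\<Sum>k\<le>m. (-1) ^ (m - k) * of_nat (m choose k) * of_nat k ^ j :: 'a::field_char_0)"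
proof -
  let ?d = "\<lambda>k. (-1) ^ (m - k) * of_nat (m choose k) :: 'a"
  have delta: "(\<Sum>k\<le>m. ?d k * (of_nat k gchoose i)) = (if i = m then 1 else 0)" for i
    using alternating_sum_gbinomial_eq_fps_nth[of m 0 1 i]
    by (simp add: fps_binomial_1 fps_X_power_nth)
  have "(\<Sum>k\<le>m. ?d k * of_nat k ^ j)
      = (\<Sum>k\<le>m. \<Sum>i\<le>j. of_nat (Stirling j i) * fact i * (?d k * (of_nat k gchoose i)))"
    by (simp add: power_eq_sum_Stirling [of _ j] ffact_eq_fact_gbinomial sum_distrib_left mult_ac)
  also have "\<dots> = (\<Sum>i\<le>j. of_nat (Stirling j i) * fact i * (\<Sum>k\<le>m. ?d k * (of_nat k gchoose i)))"
    by (subst sum.swap) (simp only: sum_distrib_left)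
  also have "\<dots> = (if m \<le> j then of_nat (Stirling j m) * fact m else 0)"
    by (simp add: delta if_distrib [of "times _"] cong: if_cong)
  also have "\<dots> = fact m * of_nat (Stirling j m)"
    by simp
  finally show ?thesis ..
qed

lemma binomial_Stirling_sum_eq_alternating_sum:
  fixes x a :: "'a::field_char_0"
  shows "fact m * (\<Sum>j=m..i. of_nat (i choose j) * of_nat (Stirling j m) * x ^ (i - j) * a ^ j)
    = (\<Sum>k\<le>m. (-1) ^ (m - k) * of_nat (m choose k) * (x + of_nat k * a) ^ i)"
proof -
  have "(\<Sum>j=m..i. of_nat (i choose j) * of_nat (Stirling j m) * x ^ (i - j) * a ^ j)
      = (\<Sum>j\<le>i. of_nat (i choose j) * of_nat (Stirling j m) * x ^ (i - j) * a ^ j)"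
    by (rule sum.mono_neutral_left) auto
  then have "fact m * (\<Sum>j=m..i. of_nat (i choose j) * of_nat (Stirling j m) * x ^ (i - j) * a ^ j)
      = (\<Sum>j\<le>i. of_nat (i choose j) * x ^ (i - j) * a ^ j * (fact m * of_nat (Stirling j m)))"
    by (simp add: sum_distrib_left mult_ac)
  also have "\<dots> = (\<Sum>k\<le>m. \<Sum>j\<le>i. (-1) ^ (m - k) * of_nat (m choose k)
      * (of_nat (i choose j) * (of_nat k * a) ^ j * x ^ (i - j)))"
    unfolding fact_Stirling_eq_alternating_sum sum_distrib_left
    by (subst sum.swap) (simp add: power_mult_distrib mult_ac)
  also have "\<dots> = (\<Sum>k\<le>m. (-1) ^ (m - k) * of_nat (m choose k) * (of_nat k * a + x) ^ i)"
    by (simp add: binomial_ring sum_distrib_left)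
  finally show ?thesis by (simp add: add.commute)
qed

text \<open>
  The inner sum is an \<open>m\<close>-th difference of \<open>i\<close>-th powers.  The outer sum is linear and sends the
  \<open>i\<close>-th powers of each node \<open>x + k a\<close> to a falling factorial, so it commutes with the difference.
\<close>

lemma Stirling_double_sum_eq_fps_nth:
  fixes x a :: "'a::field_char_0"
  shows "(\<Sum>i=m..n. \<Sum>j=m..i. (-1) ^ (n - i) * of_nat (stirling n i) * of_nat (i choose j)
      * of_nat (Stirling j m) * x ^ (i - j) * a ^ j)
    = fact n / fact m * (fps_binomial x * (fps_binomial a - 1) ^ m) $ n" (is "?S = _")
proof -
  let ?T = "\<lambda>i. \<Sum>j=m..i. of_nat (i choose j) * of_nat (Stirling j m) * x ^ (i - j) * a ^ j"
  let ?d = "\<lambda>k. (-1) ^ (m - k) * of_nat (m choose k) :: 'a"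
  have "?S = (\<Sum>i=m..n. (-1) ^ (n - i) * of_nat (stirling n i) * ?T i)"
    by (simp add: sum_distrib_left mult_ac)
  also have "\<dots> = (\<Sum>i\<le>n. (-1) ^ (n - i) * of_nat (stirling n i) * ?T i)"
    by (rule sum.mono_neutral_left) auto
  finally have "fact m * ?S = (\<Sum>i\<le>n. (-1) ^ (n - i) * of_nat (stirling n i) * (fact m * ?T i))"
    by (simp add: sum_distrib_left mult_ac)
  also have "\<dots> = (\<Sum>k\<le>m. ?d k * ffact (x + of_nat k * a) n)"
    unfolding binomial_Stirling_sum_eq_alternating_sum
    unfolding ffact_eq_sum_stirling sum_distrib_left
    by (subst sum.swap) (simp add: mult_ac)
  also have "\<dots> = fact n * (\<Sum>k\<le>m. ?d k * ((x + of_nat k * a) gchoose n))"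
    by (simp add: ffact_eq_fact_gbinomial sum_distrib_left mult_ac)
  also have "\<dots> = fact n * (fps_binomial x * (fps_binomial a - 1) ^ m) $ n"
    by (simp only: alternating_sum_gbinomial_eq_fps_nth)
  finally show ?thesis
    by (simp add: field_simps)
qed

lemma fps_binomial_times_power_nth:
  fixes x :: "'a::field_char_0"
  assumes "w $ 0 = 0"
  shows "(fps_binomial x * w ^ m) $ n = (\<Sum>l=m..n. w ^ m $ l * (x gchoose (n - l)))"
proof -
  have "(fps_binomial x * w ^ m) $ n = (\<Sum>l=0..n. w ^ m $ l * (x gchoose (n - l)))"
    by (simp add: fps_mult_nth mult.commute[of "fps_binomial x"])
  also have "\<dots> = (\<Sum>l=m..n. w ^ m $ l * (x gchoose (n - l)))"
    using startsby_zero_power_prefix[OF assms, of m]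
    by (intro sum.mono_neutral_right) auto
  finally show ?thesis .
qed

section \<open>The two coefficient sequences\<close>

text \<open>
  The hypotheses say that \<open>w\<close> is \<open>sqrt (1 + t) - 1\<close>.  From \<open>2 w + w\<^sup>2 = t\<close>, the coefficients satisfy
  \<open>2 c(m + 1, l + 1) = c(m, l) - c(m + 2, l + 1)\<close>.  In terms of the offset \<open>r = l - m\<close> this determines
  the value at \<open>(m + 1, r)\<close> from those at \<open>(m, r)\<close> and \<open>(m + 2, r - 1)\<close>, so an induction on \<open>r\<close> with an
  inner induction on \<open>m\<close> suffices, and no coefficient of the square root itself has to be known
  beyond the linear one.  The inner induction starts at \<open>m = 0\<close>, where the formula is right only
  for \<open>r > 0\<close>: at \<open>m = r = 0\<close> the quotient is 0 while the coefficient is 1.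
\<close>

lemma fps_sqrt_minus_one_power_nth:
  fixes w :: "'a::field_char_0 fps"
  assumes w0: "w $ 0 = 0" and w: "(1 + w)\<^sup>2 = 1 + fps_X" and "0 < m \<or> 0 < r"
  shows "w ^ m $ (m + r) = of_nat m / of_nat (m + r) * ((- of_nat (m + r)) gchoose r)
    * 2 powi (- int m - 2 * int r)"
proof -
  have "(1 + w)\<^sup>2 = 1 + (w + w + w * w)"
    by (simp add: power2_eq_square distrib_left distrib_right add.assoc)
  then have quad: "w + w + w * w = fps_X"
    using w by simp
  have w1: "w $ 1 = inverse 2"
  proof -
    have "(w + w + w * w) $ 1 = 1"
      unfolding quad by simp
    then show ?thesis
      using w0 by (simp add: fps_mult_nth field_simps)
  qed
  let ?c = "\<lambda>m l. w ^ m $ l"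
  have rec: "2 * ?c (Suc m) (Suc l) = ?c m l - ?c (Suc (Suc m)) (Suc l)" for m l
  proof -
    have "w ^ Suc m + w ^ Suc m + w ^ Suc (Suc m) = (w + w + w * w) * w ^ m"
      by (simp add: distrib_right mult.assoc)
    then have "(w ^ Suc m + w ^ Suc m + w ^ Suc (Suc m)) $ Suc l = (fps_X * w ^ m) $ Suc l"
      unfolding quad by (rule arg_cong)
    then have "?c (Suc m) (Suc l) + ?c (Suc m) (Suc l) + ?c (Suc (Suc m)) (Suc l) = ?c m l"
      by (simp only: fps_add_nth) simp
    then show ?thesis by (simp only: mult_2 eq_diff_eq)
  qed
  show ?thesis
    using assms(3)
  proof (induction r arbitrary: m)
    case 0
    show ?case
      using 0 w0 by (simp add: startsby_zero_power_nth_same power_int_minus power_one_over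
          inverse_eq_divide w1 [unfolded One_nat_def])
  next
    case (Suc r)
    note IH = Suc.IH
    show ?case
    proof (induction m)
      case 0
      then show ?case by simp
    next
      case (Suc m)
      define L where "L = m + r + 2"
      define B where "B = ((- of_nat L :: 'a) gchoose r)"
      define p where "p = (2 :: 'a) powi (- int (Suc m) - 2 * int (Suc r))"
      have L1: "of_nat L - 1 = (of_nat (Suc (m + r)) :: 'a)"
        by (simp add: L_def)
      have L0: "of_nat L \<noteq> (0::'a)" "of_nat L - 1 \<noteq> (0::'a)"
        unfolding L1 of_nat_eq_0_iff by (simp_all add: L_def)
      have "- int m - 2 * int (Suc r) = (- int (Suc m) - 2 * int (Suc r)) + 1"
        "- int (Suc (Suc m)) - 2 * int r = (- int (Suc m) - 2 * int (Suc r)) + 1"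
        by simp_all
      moreover have "(2 :: 'a) powi (k + 1) = 2 powi k * 2" for k
        by (simp add: power_int_add)
      ultimately have p2: "(2 :: 'a) powi (- int m - 2 * int (Suc r)) = p * 2"
        "(2 :: 'a) powi (- int (Suc (Suc m)) - 2 * int r) = p * 2"
        unfolding p_def by (simp_all only:)
      \<comment> \<open>All three binomial coefficients in the recursion are rational multiples of \<open>B\<close>.\<close>
      have b1: "((- of_nat L :: 'a) gchoose Suc r) = - (of_nat L + of_nat r) / of_nat (Suc r) * B"
        using gbinomial_mult_1[of "- of_nat L :: 'a" r] of_nat_neq_0[of r, where 'a = 'a]
        by (simp add: B_def field_simps del: of_nat_Suc)
      have b2: "((1 - of_nat L :: 'a) gchoose Suc r) = (1 - of_nat L) / of_nat (Suc r) * B"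
        using gbinomial_factors[of "- of_nat L :: 'a" r] by (simp add: B_def)
      have i1: "?c m (m + Suc r) = of_nat m / (of_nat L - 1) * ((1 - of_nat L) gchoose Suc r) * (p * 2)"
      proof -
        have L': "of_nat (m + Suc r) = (of_nat L - 1 :: 'a)" by (simp add: L_def)
        show ?thesis using Suc.IH unfolding p2 L' by simp
      qed
      have i2: "?c (Suc (Suc m)) (Suc (Suc m) + r) = (of_nat m + 2) / of_nat L * B * (p * 2)"
      proof -
        have L': "Suc (Suc m) + r = L" by (simp add: L_def)
        show ?thesis using IH[of "Suc (Suc m)"] unfolding p2 L' B_def by (simp add: add.commute)
      qed
      have "2 * ?c (Suc m) (Suc m + Suc r) = ?c m (m + Suc r) - ?c (Suc (Suc m)) (Suc (Suc m) + r)"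
        using rec[of m "m + Suc r"] by simp
      also have "\<dots> = (of_nat m / (of_nat L - 1) * ((1 - of_nat L) / of_nat (Suc r))
          - (of_nat m + 2) / of_nat L) * B * (p * 2)"
        unfolding i1 i2 b2 by (simp only: left_diff_distrib times_divide_eq_left
            times_divide_eq_right mult.assoc)
      also have "of_nat m / (of_nat L - 1) * ((1 - of_nat L) / of_nat (Suc r))
          - (of_nat m + 2) / of_nat L
          = of_nat (Suc m) / of_nat L * (- (of_nat L + of_nat r) / of_nat (Suc r) :: 'a)"
      proof -
        have "of_nat m / (of_nat L - 1) * ((1 - of_nat L) / of_nat (Suc r))
            = - (of_nat m / of_nat (Suc r) :: 'a)"
          using L0 by (simp add: divide_simps del: of_nat_Suc) (simp add: algebra_simps)
        moreover have "- (of_nat m / of_nat (Suc r)) - (of_nat m + 2) / of_nat L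
          = of_nat (Suc m) / of_nat L * (- (of_nat L + of_nat r) / of_nat (Suc r) :: 'a)"
          using L0(1) of_nat_neq_0[of r, where 'a = 'a]
          by (simp add: divide_simps del: of_nat_Suc) (simp add: L_def algebra_simps)
        ultimately show ?thesis by simp
      qed
      finally have "2 * ?c (Suc m) (Suc m + Suc r)
          = 2 * (of_nat (Suc m) / of_nat L * ((- of_nat L) gchoose Suc r) * p)"
        unfolding b1 by (simp only: mult_ac)
      then have "?c (Suc m) (Suc m + Suc r)
          = of_nat (Suc m) / of_nat L * ((- of_nat L) gchoose Suc r) * p"
        by (simp only: mult_cancel_left) simp
      moreover have "Suc m + Suc r = L" by (simp add: L_def)
      ultimately show ?case unfolding p_def by simp
    qed
  qed
qed

lemma fps_binomial_half_minus_one_power_nth: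
  "(fps_binomial (1/2 :: 'a::field_char_0) - 1) ^ m $ l = of_nat m / of_nat l
    * ((- of_nat l) gchoose (l - m)) * 2 powi (int m - 2 * int l)"
  if "0 < m" "m \<le> l"
proof -
  have "(1 + (fps_binomial (1/2 :: 'a) - 1))\<^sup>2 = 1 + fps_X"
    by (simp add: fps_binomial_power fps_binomial_1)
  then show ?thesis
    using that fps_sqrt_minus_one_power_nth[of "fps_binomial (1/2 :: 'a) - 1" m "l - m"]
    by (simp add: of_nat_diff algebra_simps)
qed

lemma fps_binomial_2_minus_one_power_nth:
  "(fps_binomial (2 :: 'a::field_char_0) - 1) ^ m $ l
    = of_nat (m choose (l - m)) * 2 powi (2 * int m - int l)"
  if "m \<le> l"
proof -
  have "fps_binomial (2 :: 'a) - 1 = fps_X * (fps_X + 2)"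
    using fps_binomial_of_nat[of 2, where 'a = 'a] by (simp add: power2_eq_square algebra_simps)
  then have "(fps_binomial (2 :: 'a) - 1) ^ m $ l = (fps_X + 2) ^ m $ (l - m)"
    using that by (simp add: power_mult_distrib fps_X_power_mult_nth)
  also have "\<dots> = (\<Sum>k\<le>m. (of_nat (m choose k) * fps_X ^ k * 2 ^ (m - k)) $ (l - m))"
    by (simp add: binomial_ring fps_sum_nth)
  also have "\<dots> = (\<Sum>k\<le>m. if k = l - m then of_nat (m choose k) * 2 ^ (m - k) else 0)"
  proof (rule sum.cong[OF refl])
    fix k
    have monom: "(of_nat (m choose k) * fps_X ^ k * 2 ^ (m - k) :: 'a fps)
        = fps_const (of_nat (m choose k) * 2 ^ (m - k)) * fps_X ^ k"
      by (simp only: fps_of_nat [symmetric] numeral_fps_const fps_const_power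
          fps_const_mult [symmetric] mult_ac)
    show "(of_nat (m choose k) * fps_X ^ k * 2 ^ (m - k)) $ (l - m)
        = (if k = l - m then of_nat (m choose k) * 2 ^ (m - k) else (0 :: 'a))"
      unfolding monom by (simp add: fps_X_power_nth)
  qed
  also have "\<dots> = of_nat (m choose (l - m)) * 2 powi (2 * int m - int l)"
  proof (cases "l - m \<le> m")
    case True
    then have "2 * int m - int l = int (m - (l - m))" using that by simp
    then show ?thesis using True by (simp del: of_nat_diff)
  qed simp
  finally show ?thesis .
qed

section \<open>The identities\<close>

theorem theorem8:
  fixes m n :: nat
  assumes "1 \<le> m" and "m \<le> n"
  shows "((\<Sum>i=m..n. \<Sum>j=m..i.
            smult ((-1) ^ (n + i) * of_nat (stirling n i) * of_nat (i choose j)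
                    * of_nat (Stirling j m) * 2 ^ (n - j))
              (lam ^ (i - j)))
         = smult (fact n / fact m)
             (\<Sum>l=m..n.
                smult (of_nat m / of_nat l * ((- of_nat l) gchoose (l - m))
                        * 2 powi (int m + int n - 2 * int l))
                  (lam pchoose (n - l))))
       \<and>
         ((\<Sum>i=m..n. \<Sum>j=m..i.
            smult ((-1) ^ (m + i) * of_nat (stirling n i) * of_nat (i choose j)
                    * of_nat (Stirling j m) * 2 ^ (j - m))
              (lam ^ (i - j)))
         = smult (fact n / fact m)
             (\<Sum>l=m..n.
                smult ((-1) ^ (m + n) * of_nat (m choose (l - m))
                        * 2 powi (int m - int l))
                  (lam pchoose (n - l))))"
proof -
  \<comment> \<open>The factor \<open>b\<close> absorbs the powers of 2 and the sign by which the coefficients differ from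
    the normalized sum: \<open>2 ^ n\<close> for \<open>a = 1/2\<close> and \<open>(-1) ^ (m + n) / 2 ^ m\<close> for \<open>a = 2\<close>.\<close>
  have poly_double_sum: "poly (\<Sum>i=m..n. \<Sum>j=m..i. smult (c i j) (lam ^ (i - j))) x
      = b * (fact n / fact m * (\<Sum>l=m..n. (fps_binomial a - 1) ^ m $ l * (x gchoose (n - l))))"
    if "\<And>i j. \<lbrakk>m \<le> j; j \<le> i; i \<le> n\<rbrakk> \<Longrightarrow> c i j = b * ((-1) ^ (n - i) * of_nat (stirling n i)
        * of_nat (i choose j) * of_nat (Stirling j m) * a ^ j)"
    for a b x :: rat and c
  proof -
    have "poly (\<Sum>i=m..n. \<Sum>j=m..i. smult (c i j) (lam ^ (i - j))) x
        = b * (\<Sum>i=m..n. \<Sum>j=m..i. (-1) ^ (n - i) * of_nat (stirling n i)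
            * of_nat (i choose j) * of_nat (Stirling j m) * x ^ (i - j) * a ^ j)"
      unfolding sum_distrib_left poly_sum
      by (intro sum.cong refl) (simp add: that poly_power)
    also have "\<dots> = b * (fact n / fact m
        * (\<Sum>l=m..n. (fps_binomial a - 1) ^ m $ l * (x gchoose (n - l))))"
      by (simp add: Stirling_double_sum_eq_fps_nth fps_binomial_times_power_nth)
    finally show ?thesis .
  qed
  have poly_single_sum: "poly (smult (fact n / fact m) (\<Sum>l=m..n. smult (c l) (lam pchoose (n - l)))) x
      = b * (fact n / fact m * (\<Sum>l=m..n. (fps_binomial a - 1) ^ m $ l * (x gchoose (n - l))))"
    if "\<And>l. \<lbrakk>m \<le> l; l \<le> n\<rbrakk> \<Longrightarrow> c l = b * (fps_binomial a - 1) ^ m $ l" for a b x :: rat and c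
  proof -
    have "(\<Sum>l=m..n. c l * (x gchoose (n - l)))
        = b * (\<Sum>l=m..n. (fps_binomial a - 1) ^ m $ l * (x gchoose (n - l)))"
      unfolding sum_distrib_left by (intro sum.cong refl) (simp add: that)
    then show ?thesis by (simp add: poly_sum poly_pbinomial)
  qed
  \<comment> \<open>Both sides are compared as polynomial functions, because evaluation turns \<open>pchoose\<close> into
    \<open>gchoose\<close>.\<close>
  show ?thesis (is "?La = ?Ra \<and> ?Lb = ?Rb")
  proof (intro conjI; subst poly_eq_poly_eq_iff [symmetric]; intro ext)
    fix x :: rat
    show "poly ?La x = poly ?Ra x"
    proof (rule trans [OF poly_double_sum poly_single_sum [symmetric]])
      fix i j assume "m \<le> j" "j \<le> i" "i \<le> n"
      then show "(-1) ^ (n + i) * of_nat (stirling n i) * of_nat (i choose j)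
          * of_nat (Stirling j m) * 2 ^ (n - j)
          = (2 :: rat) ^ n * ((-1) ^ (n - i) * of_nat (stirling n i)
            * of_nat (i choose j) * of_nat (Stirling j m) * (1/2) ^ j)"
        by (simp add: power_diff power_one_over minus_one_power_iff)
    next
      fix l assume "m \<le> l" "l \<le> n"
      have "(2 :: rat) powi (int m + int n - 2 * int l) = 2 ^ n * 2 powi (int m - 2 * int l)"
        using power_int_add[of "2 :: rat" "int n" "int m - 2 * int l"] by (simp add: algebra_simps)
      then show "of_nat m / of_nat l * ((- of_nat l) gchoose (l - m))
          * 2 powi (int m + int n - 2 * int l)
          = (2 :: rat) ^ n * (fps_binomial (1/2) - 1) ^ m $ l"
        using \<open>1 \<le> m\<close> \<open>m \<le> l\<close> by (simp add: fps_binomial_half_minus_one_power_nth)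
    qed
    show "poly ?Lb x = poly ?Rb x"
    proof (rule trans [OF poly_double_sum poly_single_sum [symmetric]])
      fix i j assume "m \<le> j" "j \<le> i" "i \<le> n"
      then show "(-1) ^ (m + i) * of_nat (stirling n i) * of_nat (i choose j)
          * of_nat (Stirling j m) * 2 ^ (j - m)
          = (-1) ^ (m + n) / (2 :: rat) ^ m * ((-1) ^ (n - i) * of_nat (stirling n i)
            * of_nat (i choose j) * of_nat (Stirling j m) * 2 ^ j)"
        by (simp add: power_diff minus_one_power_iff)
    next
      fix l assume "m \<le> l" "l \<le> n"
      have "(2 :: rat) powi (2 * int m - int l) = 2 ^ m * 2 powi (int m - int l)"
        using power_int_add[of "2 :: rat" "int m" "int m - int l"] by (simp add: algebra_simps)
      then show "(-1) ^ (m + n) * of_nat (m choose (l - m)) * 2 powi (int m - int l)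
          = (-1) ^ (m + n) / (2 :: rat) ^ m * (fps_binomial 2 - 1) ^ m $ l"
        using \<open>m \<le> l\<close> by (simp add: fps_binomial_2_minus_one_power_nth)
    qed
  qed
qed

end
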